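(* Let $f\in\mathcal{F}_d(p)$ be the type-0 pmf associated with a fundamental polynomial. Then $f$ is an extremal probability mass function, i.e. an extremal point of the convex polytope $\mathcal{F}_d(p)$.
   Context: Let $d\ge 3$, $D=2^d$, and let $p=s/t\in\mathbb{Q}$ with positive integers $s,t$ and $0<p\le 1/2$; put $c=(1-p)/p=(t-s)/s$. $\mathcal{F}_d(p)$ is the set of probability mass functions (pmfs) on $\{0,1\}^d$ all of whose univariate marginals are Bernoulli with parameter $p$; it is a convex polytope in $\mathbb{R}^D$. A pmf is identified with the vector $f=(f_1,\ldots,f_D)$, where $f_i$ is the probability of the point $(x_1,\ldots,x_d)\in\{0,1\}^d$ with $i=1+\sum_{k=1}^d x_k2^{k-1}$. The fundamental polynomials are, for $2\le n\le d-1$ and $1\le j_1<\cdots<j_n\le d-1$, $$F_{j_1,\ldots,j_n}(x)=\prod_{i=1}^nx_{j_i}-\sum_{i=1}^nx_{j_i}+(n-1)\in\mathbb{Q}[x_1,\ldots,x_{d-1}].$$ For $1\le j\le D/2$ let $m_j(x)=\prod_{k=1}^{d-1}x_k^{\varepsilon_k}$, where $\varepsilon_k\in\{0,1\}$ and $j=1+\sum_{k=1}^{d-1}\varepsilon_k2^{k-1}$. Let $P=\sum_{j=1}^{D/2}a_jm_j(x)\neq0$ be a polynomial vanishing at $(1,\ldots,1)$ and at all points $(1,\ldots,1,-c,1,\ldots,1)$. The type-0 pmf associated with $P$ is obtained as follows. For $j=2,\ldots,D/2$: if $a_j\ge0$ then $f_j=a_j$, $f_{D+1-j}=0$; if $a_j<0$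 then $f_j=0$, $f_{D+1-j}=-a_j$. With $c_0=a_1+\frac{2s-t}{s}\sum_{2\le j\le D/2,\ a_j<0}a_j$: if $c_0\ge0$ then $f_1=c_0$, $f_D=0$; if $c_0<0$ then $f_1=0$, $f_D=-c_0/c$. Finally, divide the vector $(f_1,\ldots,f_D)$ by $\sum_{j=1}^Df_j$. The resulting vector belongs to $\mathcal{F}_d(p)$. *)

theory Defs
  imports "HOL-Probability.Probability" "HOL-Library.Poly_Mapping"
begin

text \<open>
  The cube \<open>{0,1}\<^sup>d\<close> is the type \<^typ>\<open>bool ^ 'n\<close> with \<open>d = CARD('n)\<close>, and \<open>\<real>\<^sup>D\<close> is
  \<^typ>\<open>real ^ (bool ^ 'n)\<close>. Since \<open>'n\<close> is an abstract index type, a bijection \<open>e\<close> from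
  \<open>{1..d}\<close> onto \<open>'n\<close> names its elements: the coordinate \<open>x\<^sub>k\<close> of \<open>x\<close> is \<open>x $ e k\<close>.
\<close>

definition cube_index :: "(nat \<Rightarrow> 'n::finite) \<Rightarrow> nat \<Rightarrow> bool ^ 'n \<Rightarrow> nat" where
  "cube_index e d x = 1 + (\<Sum>k = 1..d. of_bool (x $ e k) * 2 ^ (k - 1))"

definition bernoulli_class :: "real \<Rightarrow> (real ^ (bool ^ 'n::finite)) set" where
  "bernoulli_class p =
     {(\<chi> x. pmf \<mu> x) | \<mu> :: (bool ^ 'n) pmf. \<forall>k. map_pmf (\<lambda>x. x $ k) \<mu> = bernoulli_pmf p}"

text \<open>
  Polynomials over the rationals in variables indexed by \<^typ>\<open>nat\<close>: finitely supported maps from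
  exponent vectors to coefficients, with the convolution product of \<open>Poly_Mapping\<close>.
\<close>

type_synonym rat_mpoly = "(nat \<Rightarrow>\<^sub>0 nat) \<Rightarrow>\<^sub>0 rat"

definition pvar :: "nat \<Rightarrow> rat_mpoly" where
  "pvar k = Poly_Mapping.single (Poly_Mapping.single k 1) 1"

definition fundamental_poly :: "nat \<Rightarrow> (nat \<Rightarrow> nat) \<Rightarrow> rat_mpoly" where
  "fundamental_poly n j = (\<Prod>i = 1..n. pvar (j i)) - (\<Sum>i = 1..n. pvar (j i)) + of_nat (n - 1)"

definition fundamental_polys :: "nat \<Rightarrow> rat_mpoly set" where
  "fundamental_polys d =
     {fundamental_poly n j | n j.
        2 \<le> n \<and> n \<le> d - 1 \<and> strict_mono_on {1..n} j \<and> j ` {1..n} \<subseteq> {1..d - 1}}"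

text \<open>
  \<open>mono_exponent d j\<close> is the exponent vector of \<open>m\<^sub>j\<close>: the exponent \<open>\<epsilon>\<^sub>k\<close> of \<open>x\<^sub>k\<close> is the
  binary digit of \<open>j - 1\<close> of weight \<open>2 ^ (k - 1)\<close>.
\<close>

definition mono_exponent :: "nat \<Rightarrow> nat \<Rightarrow> nat \<Rightarrow>\<^sub>0 nat" where
  "mono_exponent d j = (\<Sum>k = 1..d - 1. Poly_Mapping.single k (of_bool (bit (j - 1) (k - 1))))"

definition mono_coeff :: "nat \<Rightarrow> rat_mpoly \<Rightarrow> nat \<Rightarrow> real" where
  "mono_coeff d P j = real_of_rat (Poly_Mapping.lookup P (mono_exponent d j))"

definition type0_const :: "nat \<Rightarrow> nat \<Rightarrow> nat \<Rightarrow> rat_mpoly \<Rightarrow> real" where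
  "type0_const d s t P =
     mono_coeff d P 1
     + (2 * real s - real t) / real s
       * (\<Sum>j \<in> {j \<in> {2..2 ^ (d - 1)}. mono_coeff d P j < 0}. mono_coeff d P j)"

text \<open>
  The entry \<open>f\<^sub>i\<close>, \<open>1 \<le> i \<le> D = 2 ^ d\<close>, before normalization. In the last case \<open>D/2 < i < D\<close>,
  so \<open>i = D + 1 - j\<close> with \<open>2 \<le> j \<le> D/2\<close>.
\<close>

definition type0_weight :: "nat \<Rightarrow> nat \<Rightarrow> nat \<Rightarrow> rat_mpoly \<Rightarrow> nat \<Rightarrow> real" where
  "type0_weight d s t P i =
     (let a = mono_coeff d P; c0 = type0_const d s t P; c = (real t - real s) / real s in
      if i = 1 then (if c0 \<ge> 0 then c0 else 0)
      else if i = 2 ^ d then (if c0 \<ge> 0 then 0 else - c0 / c)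
      else if i \<le> 2 ^ (d - 1) then (if a i \<ge> 0 then a i else 0)
      else (let j = 2 ^ d + 1 - i in if a j \<ge> 0 then 0 else - a j))"

text \<open>
  The recipe is meant for nonzero multilinear \<open>P\<close> in \<open>x\<^sub>1, \<dots>, x\<^sub>d\<^sub>-\<^sub>1\<close> that vanish at
  \<open>(1, \<dots>, 1)\<close> and at all points \<open>(1, \<dots>, 1, -c, 1, \<dots>, 1)\<close> with \<open>c = (t - s) / s\<close>, as the
  fundamental polynomials do; for other \<open>P\<close> the value need not be a pmf.
\<close>

definition type0_pmf ::
  "(nat \<Rightarrow> 'n::finite) \<Rightarrow> nat \<Rightarrow> nat \<Rightarrow> nat \<Rightarrow> rat_mpoly \<Rightarrow> real ^ (bool ^ 'n)" where
  "type0_pmf e d s t P =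
     (\<chi> x. type0_weight d s t P (cube_index e d x) / (\<Sum>i = 1..2 ^ d. type0_weight d s t P i))"

end

theory Submission
  imports Defs "HOL-Library.Nat_Bijection"
begin

text \<open>
  For \<open>P = F\<^bsub>j\<^sub>1,\<dots>,j\<^sub>n\<^esub>\<close> and \<open>J = {j\<^sub>1,\<dots>,j\<^sub>n}\<close> the recipe gives \<open>c\<^sub>0 = n c - 1 > 0\<close>, so the type-0 pmf
  lives on \<open>n + 2\<close> points: the origin, the indicator of \<open>J\<close>, and the \<open>n\<close> points that are \<open>0\<close> exactly at
  one \<open>k \<in> J\<close>. A pmf \<open>g\<close> in the class supported on these points is unique: the marginal at a
  coordinate outside \<open>J\<close> (such as \<open>d\<close>) says that the last \<open>n\<close> masses sum to \<open>p\<close>, and comparing it with the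
  marginal at \<open>k \<in> J\<close> shows that each of them equals the mass at the indicator of \<open>J\<close>. All these masses
  are therefore \<open>p / n\<close>. Two pmfs with \<open>f\<close> strictly between them are supported where \<open>f\<close> is, so they
  coincide.
\<close>

section \<open>The class as a polytope given by linear conditions\<close>

text \<open>A law on \<open>bool\<close> is determined by its mass at \<open>True\<close>, so each
  marginal condition amounts to one linear equation. Conversely, nonnegative entries with sum 1 are
  the masses of an actual pmf, which \<open>embed_pmf\<close> supplies.\<close>

lemma bernoulli_class_iff:
  fixes g :: "real ^ (bool ^ 'n::finite)"
  assumes p: "0 \<le> p" "p \<le> 1"
  shows "g \<in> bernoulli_class p \<longleftrightarrow>
    (\<forall>x. 0 \<le> g $ x) \<and> (\<Sum>x\<in>UNIV. g $ x) = 1 \<and>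
    (\<forall>k. (\<Sum>x\<in>UNIV. g $ x * of_bool (x $ k)) = p)"
    (is "?lhs \<longleftrightarrow> ?rhs")
proof -
  have marginal: "pmf (map_pmf (\<lambda>x. x $ k) \<mu>) True = (\<Sum>x\<in>UNIV. pmf \<mu> x * of_bool (x $ k))"
    for \<mu> :: "(bool ^ 'n) pmf" and k
  proof -
    have "pmf (map_pmf (\<lambda>x. x $ k) \<mu>) True = (\<Sum>x | x $ k. pmf \<mu> x)"
      by (simp add: pmf_map measure_measure_pmf_finite vimage_def)
    also have "\<dots> = (\<Sum>x\<in>UNIV. pmf \<mu> x * of_bool (x $ k))"
      by (rule sum.mono_neutral_cong_left) auto
    finally show ?thesis .
  qed
  show ?thesis
  proof
    assume ?lhs
    then obtain \<mu> :: "(bool ^ 'n) pmf" where g: "g = (\<chi> x. pmf \<mu> x)"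
      and marg: "\<And>k. map_pmf (\<lambda>x. x $ k) \<mu> = bernoulli_pmf p"
      unfolding bernoulli_class_def by blast
    have "(\<Sum>x\<in>UNIV. pmf \<mu> x) = 1"
      by (rule sum_pmf_eq_1) auto
    moreover have "(\<Sum>x\<in>UNIV. pmf \<mu> x * of_bool (x $ k)) = p" for k
      using marginal[of k \<mu>] p by (simp add: marg)
    ultimately show ?rhs by (simp add: g)
  next
    assume rhs: ?rhs
    define \<mu> where "\<mu> = embed_pmf (($) g)"
    have \<mu>: "pmf \<mu> x = g $ x" for x
      unfolding \<mu>_def
      by (rule pmf_embed_pmf) (use rhs in \<open>auto simp: nn_integral_count_space_finite sum_ennreal\<close>)
    have "map_pmf (\<lambda>x. x $ k) \<mu> = bernoulli_pmf p" for k
    proof (rule pmf_eqI)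
      have T: "pmf (map_pmf (\<lambda>x. x $ k) \<mu>) True = p"
        unfolding marginal \<mu> using rhs by blast
      show "pmf (map_pmf (\<lambda>x. x $ k) \<mu>) b = pmf (bernoulli_pmf p) b" for b
        using T p by (cases b) (simp_all add: pmf_False_conv_True)
    qed
    moreover have "g = (\<chi> x. pmf \<mu> x)" by (simp add: \<mu> vec_eq_iff)
    ultimately show ?lhs unfolding bernoulli_class_def by blast
  qed
qed

section \<open>Pmfs supported on the star of a coordinate set\<close>

definition star_support :: "'n set \<Rightarrow> (bool ^ 'n::finite) set" where
  "star_support E = {\<chi> i. False, \<chi> i. i \<in> E} \<union> (\<lambda>k. \<chi> i. i \<noteq> k) ` E"

text \<open>The listed points are pairwise distinct: a coordinate in \<open>E\<close> separates the
  origin from the indicator of \<open>E\<close>, and a coordinate outside \<open>E\<close> separates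
  both from the points with a single zero. Hence the sum over the support splits without double
  counting.\<close>

lemma sum_star_support:
  fixes g :: "real ^ (bool ^ 'n::finite)"
  assumes E: "E \<noteq> {}" "E \<noteq> UNIV" and g: "\<And>x. x \<notin> star_support E \<Longrightarrow> g $ x = 0"
  shows "(\<Sum>x\<in>UNIV. g $ x * h x) =
    g $ (\<chi> i. False) * h (\<chi> i. False) + g $ (\<chi> i. i \<in> E) * h (\<chi> i. i \<in> E) +
    (\<Sum>k\<in>E. g $ (\<chi> i. i \<noteq> k) * h (\<chi> i. i \<noteq> k))"
proof -
  from E obtain z where z: "z \<notin> E" by blast
  have inj: "inj_on (\<lambda>k. \<chi> i. i \<noteq> k) E"
    by (auto simp: inj_on_def vec_eq_iff)
  have 1: "(\<chi> i. False) \<notin> insert (\<chi> i. i \<in> E) ((\<lambda>k. \<chi> i. i \<noteq> k) ` E)"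
    using E z by (auto simp: vec_eq_iff) metis
  have 2: "(\<chi> i. i \<in> E) \<notin> (\<lambda>k. \<chi> i. i \<noteq> k) ` E"
    using z by (auto simp: vec_eq_iff)
  have "(\<Sum>x\<in>UNIV. g $ x * h x) = (\<Sum>x\<in>star_support E. g $ x * h x)"
    by (rule sum.mono_neutral_right) (use g in auto)
  also have "star_support E =
      insert (\<chi> i. False) (insert (\<chi> i. i \<in> E) ((\<lambda>k. \<chi> i. i \<noteq> k) ` E))"
    by (auto simp: star_support_def)
  finally show ?thesis
    using 1 2 by (simp add: sum.reindex[OF inj])
qed

lemma bernoulli_class_star_unique:
  fixes g :: "real ^ (bool ^ 'n::finite)"
  assumes p: "0 \<le> p" "p \<le> 1" and E: "E \<noteq> {}" "E \<noteq> UNIV"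
    and mem: "g \<in> bernoulli_class p" and supp: "\<And>x. x \<notin> star_support E \<Longrightarrow> g $ x = 0"
  shows "g = (\<chi> x. if x = (\<chi> i. False) then 1 - p - p / card E
    else if x \<in> star_support E then p / card E else 0)"
proof -
  let ?u = "g $ (\<chi> i. i \<in> E)" and ?v = "\<lambda>k. g $ (\<chi> i. i \<noteq> k)"
  note S = sum_star_support[OF E supp]
  have tot: "(\<Sum>x\<in>UNIV. g $ x) = 1"
    and marg: "\<And>k. (\<Sum>x\<in>UNIV. g $ x * of_bool (x $ k)) = p"
    using mem p by (auto simp: bernoulli_class_iff)
  from E obtain z where z: "z \<notin> E" by blast
  have sum_v: "(\<Sum>k\<in>E. ?v k) = p"
  proof -
    \<comment> \<open>At \<open>z\<close> the origin and the indicator of \<open>E\<close> are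
      \<open>False\<close>, while every point with its single zero in \<open>E\<close> is
      \<open>True\<close>.\<close>
    have "(\<Sum>k\<in>E. ?v k) = (\<Sum>k\<in>E. ?v k * of_bool (z \<noteq> k))"
      using z by (intro sum.cong) auto
    with marg[of z] z show ?thesis by (simp add: S del: sum_mult_of_bool_eq)
  qed
  have v: "?v k = ?u" if "k \<in> E" for k
  proof -
    have "(\<Sum>l\<in>E. ?v l * of_bool (k \<noteq> l)) = (\<Sum>l\<in>E - {k}. ?v l)"
      by (rule sum.mono_neutral_cong_right) auto
    with marg[of k] that sum_v show ?thesis
      by (simp add: S sum_diff1 del: sum_mult_of_bool_eq)
  qed
  have "real (card E) * ?u = p" using sum_v v by simp
  then have u: "?u = p / card E" using E by (simp add: field_simps)
  have "g $ (\<chi> i. False) = 1 - p - p / card E"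
    using S[of "\<lambda>_. 1"] tot u sum_v by simp
  then show ?thesis
    using u v supp by (subst vec_eq_iff) (auto simp: star_support_def)
qed

lemma star_extreme_point:
  fixes f :: "real ^ (bool ^ 'n::finite)"
  assumes p: "0 < p" "p \<le> 1 / 2" and E: "2 \<le> card E" "E \<noteq> UNIV"
    and f: "f = (\<chi> x. if x = (\<chi> i. False) then 1 - p - p / card E
      else if x \<in> star_support E then p / card E else 0)"
  shows "f extreme_point_of bernoulli_class p"
proof -
  have E0: "E \<noteq> {}" using E by auto
  from E obtain z where z: "z \<notin> E" by blast
  have supp: "f $ x = 0" if "x \<notin> star_support E" for x
    using that by (auto simp: f star_support_def)
  have at_E: "f $ (\<chi> i. i \<in> E) = p / card E"
    using E0 by (auto simp: f star_support_def vec_eq_iff)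
  have at_co: "f $ (\<chi> i. i \<noteq> k) = p / card E" if "k \<in> E" for k
    using z that by (auto simp: f star_support_def vec_eq_iff)
  have at_0: "f $ (\<chi> i. False) = 1 - p - p / card E" by (simp add: f)
  note S = sum_star_support[OF E0 \<open>E \<noteq> UNIV\<close> supp]
  \<comment> \<open>The critical entry is the one at the origin: it is at least
    \<open>1 - 3 * p / 2\<close>, which is positive because \<open>p \<le> 1 / 2\<close>.\<close>
  have "p / card E \<le> p / 2" using p E by (intro divide_left_mono) auto
  then have nonneg: "0 \<le> f $ x" for x
    using p by (auto simp: f)
  have marg: "(\<Sum>x\<in>UNIV. f $ x * of_bool (x $ k)) = p" for k
  proof -
    \<comment> \<open>For \<open>k\<close> in \<open>E\<close> the point with its zero at
      \<open>k\<close> drops out; the indicator of \<open>E\<close> restores exactly the missing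
      mass \<open>p / card E\<close>.\<close>
    have "(\<Sum>l\<in>E. f $ (\<chi> i. i \<noteq> l) * of_bool (k \<noteq> l)) = (\<Sum>l\<in>E - {k}. p / card E)"
      by (rule sum.mono_neutral_cong_right) (auto simp: at_co)
    also have "\<dots> = p - of_bool (k \<in> E) * (p / card E)"
      using E0 E by (auto simp: card_Diff_singleton of_nat_diff field_simps)
    finally show ?thesis
      by (simp add: S at_E del: sum_mult_of_bool_eq)
  qed
  have "f \<in> bernoulli_class p"
    using p E0 nonneg marg S[of "\<lambda>_. 1"] by (simp add: bernoulli_class_iff at_E at_0 at_co)
  moreover have "f \<notin> open_segment g h" if mem: "g \<in> bernoulli_class p" "h \<in> bernoulli_class p" for g h
  proof
    assume "f \<in> open_segment g h"
    then obtain u where u: "0 < u" "u < 1" and fu: "f = (1 - u) *\<^sub>R g + u *\<^sub>R h" and "g \<noteq> h"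
      by (auto simp: in_segment)
    have "g $ x = 0 \<and> h $ x = 0" if "x \<notin> star_support E" for x
    proof -
      \<comment> \<open>Both weights are positive and both entries nonnegative, so a vanishing
        combination forces both entries to vanish.\<close>
      have "(1 - u) * g $ x + u * h $ x = 0"
        using supp[OF that] by (simp add: fu)
      moreover have "0 \<le> g $ x" "0 \<le> h $ x"
        using mem p by (auto simp: bernoulli_class_iff)
      ultimately show ?thesis
        using u by (simp add: add_nonneg_eq_0_iff)
    qed
    then have "g = h"
      using bernoulli_class_star_unique[of p E g] bernoulli_class_star_unique[of p E h]
        mem p E0 E by auto
    with \<open>g \<noteq> h\<close> show False ..
  qed
  ultimately show ?thesis by (auto simp: extreme_point_of_def)
qed

section \<open>Binary indices of coordinate sets\<close>

text \<open>A point of the cube is represented by the set of its coordinates equal to 1. In this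
  form the reflection of indices \<open>i\<close> to \<open>D + 1 - i\<close> becomes the complement
  of sets, and a squarefree monomial becomes its set of variables.\<close>

definition vertex_index :: "nat set \<Rightarrow> nat" where
  "vertex_index A = 1 + (\<Sum>k\<in>A. 2 ^ (k - 1))"

lemma vertex_index_empty [simp]: "vertex_index {} = 1"
  by (simp add: vertex_index_def)

lemma bit_vertex_index:
  assumes "A \<subseteq> {1..d}" "1 \<le> k"
  shows "bit (vertex_index A - 1) (k - 1) \<longleftrightarrow> k \<in> A"
proof -
  \<comment> \<open>Truncated subtraction sends 0 and 1 to the same value; the bounds
    \<open>1 \<le> k\<close> and \<open>A \<subseteq> {1..d}\<close> exclude 0.\<close>
  have inj: "inj_on (\<lambda>k. k - 1) (insert k A)"
  proof (rule inj_onI)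
    fix a b assume "a \<in> insert k A" "b \<in> insert k A" "a - 1 = b - 1"
    moreover from this have "1 \<le> a" "1 \<le> b" using assms by auto
    ultimately show "a = b" by linarith
  qed
  have fin: "finite A" using assms finite_subset by blast
  have "vertex_index A - 1 = set_encode ((\<lambda>k. k - 1) ` A)"
    using inj by (simp add: vertex_index_def set_encode_def sum.reindex)
  then have "bit (vertex_index A - 1) (k - 1) \<longleftrightarrow> k - 1 \<in> set_decode (set_encode ((\<lambda>k. k - 1) ` A))"
    by (simp add: set_decode_def bit_iff_odd)
  also have "\<dots> \<longleftrightarrow> k - 1 \<in> (\<lambda>k. k - 1) ` A"
    using fin by simp
  also have "\<dots> \<longleftrightarrow> k \<in> A"
    using inj by (auto simp: inj_on_def)
  finally show ?thesis .
qed

lemma inj_on_vertex_index: "inj_on vertex_index (Pow {1..d})"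
proof (rule inj_onI)
  fix A B assume AB: "A \<in> Pow {1..d}" "B \<in> Pow {1..d}" and eq: "vertex_index A = vertex_index B"
  have "k \<in> A \<longleftrightarrow> k \<in> B" if "1 \<le> k" for k
    using bit_vertex_index[of A d k] bit_vertex_index[of B d k] AB eq that by simp
  with AB show "A = B" by fastforce
qed

lemma vertex_index_full: "vertex_index {1..d} = 2 ^ d"
  by (induction d) (simp_all add: vertex_index_def)

text \<open>The powers of two over \<open>A\<close> and over its complement add up to
  \<open>2 ^ d - 1\<close>, and each index carries a further 1.\<close>

lemma vertex_index_compl:
  assumes "A \<subseteq> {1..d}"
  shows "vertex_index A + vertex_index ({1..d} - A) = 2 ^ d + 1"
  using sum.subset_diff[OF assms, of "\<lambda>k. 2 ^ (k - 1) :: nat"] vertex_index_full[of d]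
  by (simp add: vertex_index_def)

text \<open>The map is an injection between sets of equal cardinality \<open>2 ^ d\<close>. The
  upper bound on an index follows because the index of the complement is at least 1.\<close>

lemma vertex_index_image: "vertex_index ` Pow {1..d} = {1..2 ^ d}"
proof (rule card_subset_eq)
  show "vertex_index ` Pow {1..d} \<subseteq> {1..2 ^ d}"
  proof clarify
    fix A :: "nat set" assume "A \<subseteq> {1..d}"
    from vertex_index_compl[OF this] show "vertex_index A \<in> {1..2 ^ d}"
      by (simp add: vertex_index_def)
  qed
  show "card (vertex_index ` Pow {1..d}) = card {1..2 ^ d :: nat}"
    by (simp only: card_image[OF inj_on_vertex_index]) (simp add: card_Pow)
qed simp

lemma vertex_index_eq_iff:
  assumes "A \<subseteq> {1..d}" "B \<subseteq> {1..d}"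
  shows "vertex_index A = vertex_index B \<longleftrightarrow> A = B"
  using inj_on_vertex_index[of d] assms by (auto simp: inj_on_def)

section \<open>Coefficients of a fundamental polynomial\<close>

lemma lookup_sum_single:
  assumes "finite B"
  shows "Poly_Mapping.lookup (\<Sum>k\<in>B. Poly_Mapping.single k 1) i = (of_bool (i \<in> B) :: nat)"
  using assms by (simp add: lookup_sum lookup_single when_def)

lemma sum_single_eq_iff:
  assumes "finite A" "finite B"
  shows "(\<Sum>k\<in>A. Poly_Mapping.single k (1::nat)) = (\<Sum>k\<in>B. Poly_Mapping.single k 1) \<longleftrightarrow> A = B"
proof
  assume "(\<Sum>k\<in>A. Poly_Mapping.single k (1::nat)) = (\<Sum>k\<in>B. Poly_Mapping.single k 1)"
  then have "(of_bool (i \<in> A) :: nat) = of_bool (i \<in> B)" for i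
    using lookup_sum_single[OF assms(1), of i] lookup_sum_single[OF assms(2), of i] by simp
  then show "A = B" by (auto simp: of_bool_eq_iff)
qed simp

lemma mono_exponent_vertex_index:
  assumes "B \<subseteq> {1..d - 1}"
  shows "mono_exponent d (vertex_index B) = (\<Sum>k\<in>B. Poly_Mapping.single k 1)"
proof -
  have "mono_exponent d (vertex_index B) =
      (\<Sum>k = 1..d - 1. Poly_Mapping.single k (of_bool (k \<in> B)))"
    unfolding mono_exponent_def using bit_vertex_index[OF assms] by (intro sum.cong) simp_all
  also have "\<dots> = (\<Sum>k\<in>B. Poly_Mapping.single k 1)"
    using assms by (intro sum.mono_neutral_cong_right) auto
  finally show ?thesis .
qed

lemma prod_pvar:
  "finite J \<Longrightarrow> (\<Prod>k\<in>J. pvar k) = Poly_Mapping.single (\<Sum>k\<in>J. Poly_Mapping.single k 1) 1"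
  by (induction J rule: finite_induct) (simp_all add: pvar_def mult_single)

lemma mono_coeff_fundamental_poly:
  assumes j: "inj_on j {1..n}" and B: "B \<subseteq> {1..d - 1}"
  shows "mono_coeff d (fundamental_poly n j) (vertex_index B) =
    of_bool (B = j ` {1..n}) - of_bool (\<exists>k\<in>j ` {1..n}. B = {k}) + of_bool (B = {}) * real (n - 1)"
proof -
  define J where "J = j ` {1..n}"
  define m :: "nat \<Rightarrow>\<^sub>0 nat" where "m = (\<Sum>k\<in>B. Poly_Mapping.single k 1)"
  have fin: "finite J" "finite B" using B by (auto simp: J_def finite_subset)
  have P: "fundamental_poly n j = (\<Prod>k\<in>J. pvar k) - (\<Sum>k\<in>J. pvar k) + of_nat (n - 1)"
    unfolding fundamental_poly_def J_def by (simp only: prod.reindex[OF j] sum.reindex[OF j] o_def)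
  have 1: "Poly_Mapping.lookup (\<Prod>k\<in>J. pvar k) m = of_bool (B = J)"
    using sum_single_eq_iff[OF fin] by (auto simp: prod_pvar[OF fin(1)] m_def lookup_single when_def)
  have "Poly_Mapping.lookup (pvar k) m = of_bool (B = {k})" for k
    using sum_single_eq_iff[of "{k}" B] fin by (auto simp: pvar_def m_def lookup_single when_def)
  then have "Poly_Mapping.lookup (\<Sum>k\<in>J. pvar k) m = (\<Sum>k\<in>J. of_bool (B = {k}))"
    by (simp add: lookup_sum)
  \<comment> \<open>At most one \<open>k\<close> satisfies \<open>B = {k}\<close>, so the sum of
    indicators is 0 or 1.\<close>
  also have "\<dots> = of_bool (\<exists>k\<in>J. B = {k})"
  proof (cases "\<exists>k\<in>J. B = {k}")
    case True
    then obtain l where "l \<in> J" "B = {l}" by blast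
    then show ?thesis using fin by simp
  qed auto
  finally have 2: "Poly_Mapping.lookup (\<Sum>k\<in>J. pvar k) m = of_bool (\<exists>k\<in>J. B = {k})" .
  have 3: "Poly_Mapping.lookup (of_nat (n - 1)) m = (of_bool (B = {}) * of_nat (n - 1) :: rat)"
    using sum_single_eq_iff[of "{}" B] fin by (auto simp: m_def lookup_of_nat when_def)
  show ?thesis
    unfolding mono_coeff_def mono_exponent_vertex_index[OF B] m_def[symmetric] P J_def[symmetric]
      lookup_add lookup_minus 1 2 3
    by (simp add: of_rat_add of_rat_diff of_rat_mult)
qed

section \<open>Type-0 weights of a fundamental polynomial\<close>

text \<open>The negative coefficients are the values -1 at the singletons of \<open>J\<close>. With
  \<open>n = card J\<close> and \<open>(2 * s - t) / s = 1 - c\<close> the constant is therefore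
  \<open>(n - 1) - n * (1 - c) = n * c - 1\<close>.\<close>

lemma type0_const_fundamental:
  assumes J: "J \<subseteq> {1..d - 1}" "2 \<le> card J" and s: "0 < s"
    and P: "\<And>B. B \<subseteq> {1..d - 1} \<Longrightarrow> mono_coeff d P (vertex_index B) =
      of_bool (B = J) - of_bool (\<exists>k\<in>J. B = {k}) + of_bool (B = {}) * real (card J - 1)"
  shows "type0_const d s t P = real (card J) * ((real t - real s) / real s) - 1"
proof -
  have neg: "mono_coeff d P (vertex_index B) < 0 \<longleftrightarrow> (\<exists>k\<in>J. B = {k})" if "B \<subseteq> {1..d - 1}" for B
    using P[OF that] J(2) by auto
  \<comment> \<open>This places singletons at indices at least 2, where the sum of negative
    coefficients starts.\<close>
  have one: "vertex_index {k} = 1 + 2 ^ (k - 1)" for k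
    by (simp add: vertex_index_def)
  let ?N = "{j \<in> {2..2 ^ (d - 1)}. mono_coeff d P j < 0}"
  have N: "?N = (\<lambda>k. vertex_index {k}) ` J"
  proof (intro equalityI subsetI)
    fix i assume i: "i \<in> ?N"
    then have "i \<in> vertex_index ` Pow {1..d - 1}"
      unfolding vertex_index_image by auto
    then obtain B where "B \<subseteq> {1..d - 1}" "i = vertex_index B" by auto
    with i neg show "i \<in> (\<lambda>k. vertex_index {k}) ` J" by auto
  next
    fix i assume "i \<in> (\<lambda>k. vertex_index {k}) ` J"
    then obtain k where k: "k \<in> J" "i = vertex_index {k}" by blast
    then have "{k} \<subseteq> {1..d - 1}" using J by auto
    then have "i \<in> {1..2 ^ (d - 1)}" "mono_coeff d P i < 0"
      using neg k vertex_index_image[of "d - 1"] by blast+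
    then show "i \<in> ?N" using one[of k] k(2) by simp
  qed
  have "inj_on (\<lambda>k. vertex_index {k}) J"
  proof (rule inj_onI)
    fix k l assume "k \<in> J" "l \<in> J" "vertex_index {k} = vertex_index {l}"
    then show "k = l"
      using J(1) vertex_index_eq_iff[of "{k}" "d - 1" "{l}"] by blast
  qed
  then have "(\<Sum>j\<in>?N. mono_coeff d P j) = (\<Sum>k\<in>J. mono_coeff d P (vertex_index {k}))"
    unfolding N by (simp add: sum.reindex)
  also have "\<dots> = (\<Sum>k\<in>J. -1)"
  proof (rule sum.cong)
    fix k assume k: "k \<in> J"
    then have "{k} \<subseteq> {1..d - 1}" "{k} \<noteq> J" using J by auto
    then show "mono_coeff d P (vertex_index {k}) = -1"
      using P[of "{k}"] k by simp
  qed simp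
  finally have sum_N: "(\<Sum>j\<in>?N. mono_coeff d P j) = - real (card J)" by simp
  have a1: "mono_coeff d P 1 = real (card J) - 1"
    using P[of "{}"] J(2) by auto
  show ?thesis
    unfolding type0_const_def sum_N a1 using s by (simp add: field_simps)
qed

text \<open>Apart from the two extreme indices, a set without \<open>d\<close> lies in the lower
  half and receives the positive part of its own coefficient, which leaves only \<open>J\<close>. A
  set containing \<open>d\<close> lies in the upper half and receives the negative part of the
  coefficient of its complement, which leaves only complements of singletons of
  \<open>J\<close>.\<close>

lemma type0_weight_fundamental:
  assumes d: "2 \<le> d" and J: "J \<subseteq> {1..d - 1}" "2 \<le> card J" and st: "0 < s" "2 * s \<le> t"
    and P: "\<And>B. B \<subseteq> {1..d - 1} \<Longrightarrow> mono_coeff d P (vertex_index B) =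
      of_bool (B = J) - of_bool (\<exists>k\<in>J. B = {k}) + of_bool (B = {}) * real (card J - 1)"
    and A: "A \<subseteq> {1..d}"
  shows "type0_weight d s t P (vertex_index A) =
    (if A = {} then real (card J) * ((real t - real s) / real s) - 1
     else if A = J \<or> (\<exists>k\<in>J. A = {1..d} - {k}) then 1 else 0)"
proof -
  let ?c = "(real t - real s) / real s"
  have c0: "type0_const d s t P = real (card J) * ?c - 1"
    by (rule type0_const_fundamental) (use J st P in auto)
  have "1 \<le> ?c" using st by (simp add: field_simps)
  \<comment> \<open>With \<open>c \<ge> 1\<close> and \<open>card J \<ge> 2\<close> the constant is
    at least 1, so the recipe gives it to the origin and nothing to the all-ones point.\<close>
  then have "2 * 1 \<le> real (card J) * ?c" using J by (intro mult_mono) auto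
  then have c0_pos: "0 < type0_const d s t P" by (simp add: c0)
  have eq_1: "vertex_index B = 1 \<longleftrightarrow> B = {}" if "B \<subseteq> {1..d}" for B
    using vertex_index_eq_iff[of B d "{}"] that by simp
  have eq_D: "vertex_index B = 2 ^ d \<longleftrightarrow> B = {1..d}" if "B \<subseteq> {1..d}" for B
    using vertex_index_eq_iff[of B d "{1..d}"] that vertex_index_full[of d] by simp
  have half: "vertex_index B \<le> 2 ^ (d - 1)" if "B \<subseteq> {1..d - 1}" for B
    using vertex_index_image[of "d - 1"] that by fastforce
  have dJ: "d \<notin> J" using J d by auto
  have Jd: "k \<in> {1..d}" if "k \<in> J" for k using that J(1) by fastforce
  have J_ne: "J \<noteq> {}" "\<And>k. J \<noteq> {k}" using J(2) by auto
  have D: "(2::nat) ^ d = 2 * 2 ^ (d - 1)" using d by (cases d) auto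
  have sub: "B \<subseteq> {1..d - 1}" if "B \<subseteq> {1..d}" "d \<notin> B" for B
  proof
    fix k assume "k \<in> B"
    with that have "k \<in> {1..d}" "k \<noteq> d" by auto
    then show "k \<in> {1..d - 1}" by auto
  qed
  \<comment> \<open>These are the four branches of the recipe: index 1, index \<open>2 ^ d\<close>,
    lower half, upper half.\<close>
  consider "A = {}" | "A = {1..d}" | "A \<noteq> {}" "d \<notin> A" | "A \<noteq> {1..d}" "d \<in> A" by blast
  then show ?thesis
  proof cases
    case 1
    then show ?thesis using c0 c0_pos by (simp add: type0_weight_def)
  next
    case 2
    moreover have "A \<noteq> J" "A \<noteq> {}"
      using 2 dJ d by auto
    moreover have "A \<noteq> {1..d} - {k}" if "k \<in> J" for k
      using 2 Jd[OF that] by blast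
    moreover have "vertex_index A \<noteq> 1" using eq_1[OF A] \<open>A \<noteq> {}\<close> by simp
    ultimately show ?thesis
      using c0_pos eq_D[OF A] by (simp add: type0_weight_def Let_def del: One_nat_def)
  next
    case 3
    note A' = sub[OF A 3(2)]
    have co: "A \<noteq> {1..d} - {k}" if "k \<in> J" for k
    proof -
      have "d \<in> {1..d} - {k}" using d dJ that by auto
      with 3 show ?thesis by blast
    qed
    have "A \<noteq> {1..d}" using 3 d by auto
    then have "type0_weight d s t P (vertex_index A) = max (mono_coeff d P (vertex_index A)) 0"
      using 3 eq_1[OF A] eq_D[OF A] half[OF A'] by (simp add: type0_weight_def Let_def)
    also have "\<dots> = of_bool (A = J)"
      using 3 P[OF A'] J_ne by auto
    finally show ?thesis using 3 co by simp
  next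
    case 4
    define B where "B = {1..d} - A"
    have B: "B \<subseteq> {1..d - 1}" "B \<noteq> {}" using sub[of B] 4 A by (auto simp: B_def)
    have idx: "2 ^ d + 1 - vertex_index A = vertex_index B"
      using vertex_index_compl[OF A] by (simp add: B_def)
    have upper: "\<not> vertex_index A \<le> 2 ^ (d - 1)"
      using vertex_index_compl[OF A] half[OF B(1)] D by (simp add: B_def)
    have co: "A = {1..d} - {k} \<longleftrightarrow> B = {k}" if "k \<in> J" for k
      unfolding B_def using Jd[OF that] A by blast
    have A_ne: "A \<noteq> J" "A \<noteq> {}" using 4 dJ by auto
    have "type0_weight d s t P (vertex_index A) = max (- mono_coeff d P (vertex_index B)) 0"
      using 4 A_ne eq_1[OF A] eq_D[OF A] upper
      by (simp add: type0_weight_def Let_def idx del: One_nat_def)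
    also have "\<dots> = of_bool (\<exists>k\<in>J. B = {k})"
      using P[OF B(1)] B(2) J_ne by auto
    finally show ?thesis using A_ne co by simp
  qed
qed

section \<open>Transfer to the cube and normalization\<close>

lemma bij_betw_cube_support:
  fixes e :: "nat \<Rightarrow> 'n::finite"
  assumes "bij_betw e {1..d} UNIV"
  shows "bij_betw (\<lambda>x :: bool ^ 'n. {k\<in>{1..d}. x $ e k}) UNIV (Pow {1..d})"
proof (rule bij_betwI)
  show "(\<chi> i. i \<in> e ` {k\<in>{1..d}. x $ e k}) = x" for x :: "bool ^ 'n"
  proof -
    have "i \<in> e ` {k\<in>{1..d}. x $ e k} \<longleftrightarrow> x $ i" for i
    proof -
      have "i \<in> e ` {1..d}" by (simp only: bij_betw_imp_surj_on[OF assms] UNIV_I)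
      then obtain k where "k \<in> {1..d}" "i = e k" by (rule imageE)
      then show ?thesis by blast
    qed
    then show ?thesis by (simp add: vec_eq_iff)
  qed
  show "{k\<in>{1..d}. (\<chi> i. i \<in> e ` A :: bool ^ 'n) $ e k} = A" if "A \<in> Pow {1..d}" for A
  proof -
    have "e k \<in> e ` A \<longleftrightarrow> k \<in> A" if "k \<in> {1..d}" for k
      using inj_on_image_mem_iff[OF bij_betw_imp_inj_on[OF assms] that] \<open>A \<in> Pow {1..d}\<close> by blast
    then have "{k\<in>{1..d}. e k \<in> e ` A} = A" using that by blast
    then show ?thesis by simp
  qed
qed auto

lemma cube_index_eq: "cube_index e d x = vertex_index {k\<in>{1..d}. x $ e k}"
proof -
  have "(\<Sum>k = 1..d. of_bool (x $ e k) * 2 ^ (k - 1)) = (\<Sum>k\<in>{k\<in>{1..d}. x $ e k}. 2 ^ (k - 1) :: nat)"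
    by (rule sum.mono_neutral_cong_right) auto
  then show ?thesis by (simp add: cube_index_def vertex_index_def)
qed

text \<open>This allows the normalizing sum over \<open>{1..2 ^ d}\<close> to be computed as a sum
  over the cube.\<close>

lemma bij_betw_cube_index:
  fixes e :: "nat \<Rightarrow> 'n::finite"
  assumes "bij_betw e {1..d} UNIV"
  shows "bij_betw (cube_index e d) UNIV {1..2 ^ d}"
proof -
  have "bij_betw vertex_index (Pow {1..d}) {1..2 ^ d}"
    by (simp add: bij_betw_def inj_on_vertex_index vertex_index_image del: One_nat_def)
  from bij_betw_trans[OF bij_betw_cube_support[OF assms] this] show ?thesis
    by (simp add: o_def cube_index_eq[abs_def])
qed

theorem proposition4p1:
  fixes d s t :: nat and p :: real and e :: "nat \<Rightarrow> 'n::finite"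
    and P :: rat_mpoly and f :: "real ^ (bool ^ 'n)"
  assumes "d \<ge> 3"
    and "bij_betw e {1..d} UNIV"
    and "s > 0" and "t > 0" and "p = real s / real t" and "0 < p" and "p \<le> 1 / 2"
    and "P \<in> fundamental_polys d"
    and "f = type0_pmf e d s t P"
  shows "f extreme_point_of bernoulli_class p"
proof -
  from \<open>P \<in> fundamental_polys d\<close> obtain n j where P: "P = fundamental_poly n j"
    and n: "2 \<le> n" "n \<le> d - 1" and j: "strict_mono_on {1..n} j" "j ` {1..n} \<subseteq> {1..d - 1}"
    unfolding fundamental_polys_def by blast
  define J where "J = j ` {1..n}"
  define E where "E = e ` J"
  define c where "c = (real t - real s) / real s"
  define w :: "real ^ (bool ^ 'n)" where "w = (\<chi> x. type0_weight d s t P (cube_index e d x))"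
  let ?ones = "\<lambda>x. {k\<in>{1..d}. x $ e k}"
  have inj_j: "inj_on j {1..n}" using j(1) by (rule strict_mono_on_imp_inj_on)
  have inj_e: "inj_on e {1..d}" using assms(2) by (rule bij_betw_imp_inj_on)
  have J: "J \<subseteq> {1..d - 1}" "card J = n"
    using j inj_j by (simp_all add: J_def card_image)
  have J_d: "J \<subseteq> {1..d}" using J(1) by fastforce
  have E: "card E = n" "E \<noteq> {}" "E \<noteq> UNIV"
  proof -
    show card: "card E = n"
      using J inj_on_subset[OF inj_e J_d] by (simp add: E_def card_image)
    show "E \<noteq> {}" using card n by auto
    \<comment> \<open>Since \<open>n \<le> d - 1\<close>, some coordinate stays outside
      \<open>E\<close>, as the uniqueness argument requires.\<close>
    have "card (UNIV :: 'n set) = d" using bij_betw_same_card[OF assms(2)] by simp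
    then show "E \<noteq> UNIV" using card n assms(1) by auto
  qed
  have st: "2 * s \<le> t"
  proof -
    have "2 * real s \<le> real t" using assms(4,5,7) by (simp add: divide_le_eq)
    then show ?thesis by linarith
  qed
  \<comment> \<open>Points may be compared through their sets of ones; the next facts translate each
    special set of the weight formula into a point of the star.\<close>
  have ones_inj: "?ones x = ?ones y \<longleftrightarrow> x = y" for x y
    using bij_betw_cube_support[OF assms(2)] by (auto simp: bij_betw_def inj_on_def)
  have e_in_E: "e k \<in> E \<longleftrightarrow> k \<in> J" if "k \<in> {1..d}" for k
    unfolding E_def using inj_on_image_mem_iff[OF inj_e that J_d] .
  have e_eq: "e k = e l \<longleftrightarrow> k = l" if "k \<in> {1..d}" "l \<in> {1..d}" for k l
    using inj_on_eq_iff[OF inj_e that] .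
  have ones_0: "?ones x = {} \<longleftrightarrow> x = (\<chi> i. False)" for x
    using ones_inj[of x "\<chi> i. False"] by simp
  have "?ones (\<chi> i. i \<in> E) = J"
    using e_in_E J_d by auto
  then have ones_E: "?ones x = J \<longleftrightarrow> x = (\<chi> i. i \<in> E)" for x
    using ones_inj[of x "\<chi> i. i \<in> E"] by simp
  have ones_co: "?ones x = {1..d} - {l} \<longleftrightarrow> x = (\<chi> i. i \<noteq> e l)" if "l \<in> J" for x l
  proof -
    have "?ones (\<chi> i. i \<noteq> e l) = {1..d} - {l}"
      using e_eq[of _ l] that J_d by auto
    then show ?thesis using ones_inj[of x "\<chi> i. i \<noteq> e l"] by simp
  qed
  have w: "w $ x = (if x = (\<chi> i. False) then real n * c - 1
      else if x \<in> star_support E then 1 else 0)" for x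
  proof -
    have "w $ x = type0_weight d s t P (vertex_index (?ones x))"
      by (simp add: w_def cube_index_eq)
    also have "\<dots> = (if ?ones x = {} then real (card J) * c - 1
        else if ?ones x = J \<or> (\<exists>k\<in>J. ?ones x = {1..d} - {k}) then 1 else 0)"
      unfolding c_def
    proof (rule type0_weight_fundamental)
      show "mono_coeff d P (vertex_index B) =
          of_bool (B = J) - of_bool (\<exists>k\<in>J. B = {k}) + of_bool (B = {}) * real (card J - 1)"
        if "B \<subseteq> {1..d - 1}" for B
        using mono_coeff_fundamental_poly[OF inj_j that] J by (simp add: P J_def)
    qed (use J n st assms in auto)
    also have "(\<exists>k\<in>J. ?ones x = {1..d} - {k}) \<longleftrightarrow> x \<in> (\<lambda>k. \<chi> i. i \<noteq> k) ` E"
      using ones_co by (auto simp: E_def image_iff)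
    finally show ?thesis
      unfolding ones_0 ones_E by (auto simp: star_support_def J)
  qed
  have w0: "w $ x = 0" if "x \<notin> star_support E" for x
    using that by (auto simp: w star_support_def)
  have "(\<Sum>i = 1..2 ^ d. type0_weight d s t P i) = (\<Sum>x\<in>UNIV. w $ x)"
    using sum.reindex_bij_betw[OF bij_betw_cube_index[OF assms(2)], of "type0_weight d s t P"]
    by (simp add: w_def)
  also have "\<dots> = (real n * c - 1) + 1 + real n"
  proof -
    from E obtain z where z: "z \<notin> E" by blast
    have "w $ (\<chi> i. False) = real n * c - 1" by (simp add: w)
    moreover have "w $ (\<chi> i. i \<in> E) = 1"
      using E by (auto simp: w star_support_def vec_eq_iff)
    moreover have "w $ (\<chi> i. i \<noteq> k) = 1" if "k \<in> E" for k
      using z that by (auto simp: w star_support_def vec_eq_iff)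
    ultimately show ?thesis
      using sum_star_support[OF E(2,3) w0, of "\<lambda>_. 1"] E by simp
  qed
  \<comment> \<open>The total is \<open>n * (c + 1)\<close>, and
    \<open>c + 1 = t / s = 1 / p\<close>.\<close>
  also have "\<dots> = real n / p"
    using assms(3,4) by (simp add: c_def assms(5) field_simps)
  finally have f: "f $ x = w $ x * p / real n" for x
    using assms(9) by (simp add: type0_pmf_def w_def)
  \<comment> \<open>Here \<open>c * p = 1 - p\<close> turns the normalized weight at the origin into
    the mass found for the unique pmf on the star.\<close>
  have "(real n * c - 1) * p / real n = 1 - p - p / real n"
    using assms(3,4) n by (simp add: c_def assms(5) field_simps)
  then have "f = (\<chi> x. if x = (\<chi> i. False) then 1 - p - p / card E
      else if x \<in> star_support E then p / card E else 0)"
    unfolding E(1) by (subst vec_eq_iff) (simp add: f w)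
  with star_extreme_point[of p E f] show ?thesis
    using assms E n by simp
qed

end
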